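(* Consider the $s$-stage RKN (Runge--Kutta--Nystr\"om) methods $$\begin{aligned} Q_i&=q_n+hc_iq_n'+h^2\sum_{j=1}^{s}a_{ij}(c_i-c_j)\tilde g(Q_j),\quad i=1,\dots,s,\\ q_{n+1}&=q_n+hq_n'+h^2\sum_{i=1}^{s}b_i(1-c_i)\tilde g(Q_i),\\ q_{n+1}'&=q_n'+h\sum_{i=1}^{s}b_i\tilde g(Q_i), \end{aligned}$$ with the coefficients $c=(c_1,\dots,c_s)^{\intercal}$, $b=(b_1,\dots,b_s)^{\intercal}$, $A=(a_{ij})_{s\times s}$ of an $s$-stage Runge--Kutta method. If this Runge--Kutta method is symplectic and $b_j\neq0$ for all $j=1,\dots,s$, then all one-stage and two-stage RKN methods of this form (and compositions thereof) are volume preserving for solving the second-order system $q''=\tilde g(q)$.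
   Context: $q\in\mathbb{R}^d$, $\tilde g:\mathbb{R}^d\to\mathbb{R}^d$ is differentiable, $h$ is the stepsize. A Runge--Kutta method is symplectic if $b_ia_{ij}+b_ja_{ji}-b_ib_j=0$ for all $i,j$. Volume preserving means that the one-step map $(q_n,q_n')\mapsto(q_{n+1},q_{n+1}')$ on $\mathbb{R}^{2d}$ has Jacobian determinant $1$ at every point; it is understood that the stage equations define $Q_1,\dots,Q_s$ as differentiable functions of $(q_n,q_n')$ with nonsingular Jacobian of the stage system with respect to $(Q_1,\dots,Q_s)$. *)

theory Defs
  imports "HOL-Analysis.Analysis"
begin

text \<open>
  Phase space \<open>\<real>\<^sup>2\<^sup>d\<close> is \<open>real ^ ('n + 'n)\<close> with \<open>d = CARD('n)\<close>, and a tuple \<open>(Q\<^sub>1, \<dots>, Q\<^sub>s)\<close> of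
  stages is an element of \<open>real ^ ('s \<times> 'n)\<close> with \<open>s = CARD('s)\<close>.  Both are flat coordinate
  vectors, so that \<^const>\<open>jacobian\<close>, \<^const>\<open>det\<close> and \<^const>\<open>invertible\<close> apply directly.
\<close>

definition position :: "real ^ ('n + 'n) \<Rightarrow> real ^ 'n" where
  "position x = (\<chi> k. x $ Inl k)"

definition velocity :: "real ^ ('n + 'n) \<Rightarrow> real ^ 'n" where
  "velocity x = (\<chi> k. x $ Inr k)"

definition phase_point :: "real ^ 'n \<Rightarrow> real ^ 'n \<Rightarrow> real ^ ('n + 'n)" where
  "phase_point q q' = (\<chi> k. case k of Inl i \<Rightarrow> q $ i | Inr i \<Rightarrow> q' $ i)"

definition stage :: "real ^ ('s::finite \<times> 'n::finite) \<Rightarrow> 's \<Rightarrow> real ^ 'n" where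
  "stage Z i = (\<chi> k. Z $ (i, k))"

definition symplectic_rk :: "real ^ 's ^ 's \<Rightarrow> real ^ 's \<Rightarrow> bool" where
  "symplectic_rk A b \<longleftrightarrow>
     (\<forall>i j. b $ i * A $ i $ j + b $ j * A $ j $ i - b $ i * b $ j = 0)"

definition stage_rhs ::
  "real ^ 's ^ 's \<Rightarrow> real ^ 's \<Rightarrow> real \<Rightarrow> (real ^ 'n \<Rightarrow> real ^ 'n) \<Rightarrow>
   real ^ ('n + 'n) \<Rightarrow> real ^ ('s \<times> 'n) \<Rightarrow> 's \<Rightarrow> real ^ 'n" where
  "stage_rhs A c h g x Z i =
     position x + (h * c $ i) *\<^sub>R velocity x +
     h\<^sup>2 *\<^sub>R (\<Sum>j\<in>UNIV. (A $ i $ j * (c $ i - c $ j)) *\<^sub>R g (stage Z j))"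

definition stage_residual ::
  "real ^ 's ^ 's \<Rightarrow> real ^ 's \<Rightarrow> real \<Rightarrow> (real ^ 'n \<Rightarrow> real ^ 'n) \<Rightarrow>
   real ^ ('n + 'n) \<Rightarrow> real ^ ('s \<times> 'n) \<Rightarrow> real ^ ('s \<times> 'n)" where
  "stage_residual A c h g x Z =
     (\<chi> p. (stage Z (fst p) - stage_rhs A c h g x Z (fst p)) $ snd p)"

text \<open>
  The standing assumption that the implicit stage equations define the stages \<open>Q x\<close> as
  differentiable functions of \<open>x = (q\<^sub>n, q\<^sub>n')\<close>, with nonsingular Jacobian of the stage system
  with respect to the stages.
\<close>

definition stage_solution ::
  "real ^ 's ^ 's \<Rightarrow> real ^ 's \<Rightarrow> real \<Rightarrow> (real ^ 'n \<Rightarrow> real ^ 'n) \<Rightarrow>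
   (real ^ ('n + 'n) \<Rightarrow> real ^ ('s \<times> 'n)) \<Rightarrow> bool" where
  "stage_solution A c h g Q \<longleftrightarrow>
     (\<forall>x i. stage (Q x) i = stage_rhs A c h g x (Q x) i) \<and>
     (\<forall>x. Q differentiable (at x)) \<and>
     (\<forall>x. invertible (jacobian (stage_residual A c h g x) (at (Q x))))"

definition rkn_step ::
  "real ^ 's \<Rightarrow> real ^ 's \<Rightarrow> real \<Rightarrow> (real ^ 'n \<Rightarrow> real ^ 'n) \<Rightarrow>
   (real ^ ('n + 'n) \<Rightarrow> real ^ ('s \<times> 'n)) \<Rightarrow> real ^ ('n + 'n) \<Rightarrow> real ^ ('n + 'n)" where
  "rkn_step b c h g Q x =
     phase_point
       (position x + h *\<^sub>R velocity x +
          h\<^sup>2 *\<^sub>R (\<Sum>i\<in>UNIV. (b $ i * (1 - c $ i)) *\<^sub>R g (stage (Q x) i)))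
       (velocity x + h *\<^sub>R (\<Sum>i\<in>UNIV. b $ i *\<^sub>R g (stage (Q x) i)))"

definition volume_preserving :: "(real ^ ('n::finite + 'n) \<Rightarrow> real ^ ('n + 'n)) \<Rightarrow> bool" where
  "volume_preserving \<Phi> \<longleftrightarrow>
     (\<forall>x. \<Phi> differentiable (at x) \<and> det (jacobian \<Phi> (at x)) = 1)"

text \<open>
  Finite compositions of one-stage and two-stage methods applied to the same equation; the
  factors may differ in number of stages, coefficients and stepsize.
\<close>

inductive_set rkn_compositions ::
  "(real ^ 'n \<Rightarrow> real ^ 'n) \<Rightarrow> (real ^ ('n + 'n) \<Rightarrow> real ^ ('n + 'n)) set"
  for g :: "real ^ 'n \<Rightarrow> real ^ 'n" where
  one_stage:
    "symplectic_rk (A :: real ^ 1 ^ 1) b \<Longrightarrow> \<forall>j. b $ j \<noteq> 0 \<Longrightarrow> stage_solution A c h g Q \<Longrightarrow>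
       rkn_step b c h g Q \<in> rkn_compositions g"
| two_stage:
    "symplectic_rk (A :: real ^ 2 ^ 2) b \<Longrightarrow> \<forall>j. b $ j \<noteq> 0 \<Longrightarrow> stage_solution A c h g Q \<Longrightarrow>
       rkn_step b c h g Q \<in> rkn_compositions g"
| compose:
    "\<Phi> \<in> rkn_compositions g \<Longrightarrow> \<Psi> \<in> rkn_compositions g \<Longrightarrow> \<Psi> \<circ> \<Phi> \<in> rkn_compositions g"

end

theory Submission
  imports Defs
begin

text \<open>
  Write \<open>m\<^sub>i\<^sub>j = h\<^sup>2 a\<^sub>i\<^sub>j (c\<^sub>i - c\<^sub>j)\<close>, and let \<open>G\<^sub>i\<close> be the Jacobian matrix of \<open>g\<close> at the
  \<open>i\<close>-th stage.  Call \<open>\<Delta>(M) = det (I - (m\<^sub>i\<^sub>j G\<^sub>j)\<^sub>i\<^sub>j)\<close>, a determinant of size \<open>s d\<close>, the stage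
  determinant.  Since \<open>\<Delta>(M)\<close> is the Jacobian determinant of the stage system, it is nonzero.

  The derivative of a step is the free flow \<open>(q, q') \<mapsto> (q + h q', q')\<close>, which has determinant \<open>1\<close>,
  plus a product of rectangular matrices that passes through the inverse of the linearized stage
  system.  Sylvester's identity \<open>det (I + X Y) = det (I + Y X)\<close> moves this perturbation from phase
  space to stage space, so that the Jacobian determinant of the step becomes a quotient
  \<open>\<Delta>(M') / \<Delta>(M)\<close> with \<open>m'\<^sub>i\<^sub>j = h\<^sup>2 (a\<^sub>i\<^sub>j - b\<^sub>j) (c\<^sub>i - c\<^sub>j)\<close> (lemma \<open>det_rkn_step_jacobian\<close>).
  This step is the same for every number of stages.

  Symplecticity says \<open>b\<^sub>i (a\<^sub>i\<^sub>j - b\<^sub>j) = - b\<^sub>j a\<^sub>j\<^sub>i\<close>, that is, \<open>b\<^sub>i m'\<^sub>i\<^sub>j = m\<^sub>j\<^sub>i b\<^sub>j\<close>.  As no weight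
  vanishes, \<open>M'\<close> is conjugate by a diagonal matrix to the transpose of \<open>M\<close>, and conjugation by a
  matrix that is scalar on each stage does not change the stage determinant.  Hence a symplectic
  method preserves volume as soon as \<open>\<Delta>(M\<^sup>T) = \<Delta>(M)\<close>.  For one stage, \<open>M = 0\<close>.  For two stages
  \<open>M\<close> has zero diagonal, and eliminating one stage gives
  \<open>\<Delta>(M) = det (I - m\<^sub>1\<^sub>2 m\<^sub>2\<^sub>1 G\<^sub>2 G\<^sub>1)\<close>, which is symmetric in \<open>m\<^sub>1\<^sub>2\<close> and \<open>m\<^sub>2\<^sub>1\<close>.  From three stages
  on, the matrices \<open>G\<^sub>i\<close> enter through products such as \<open>G\<^sub>1 G\<^sub>2 G\<^sub>3\<close> and \<open>G\<^sub>3 G\<^sub>2 G\<^sub>1\<close>, which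
  transposition exchanges; this is why the number of stages is limited.
\<close>

section \<open>Determinants of block matrices\<close>

text \<open>
  In the Leibniz sum, a unit row \<open>k\<close> kills every permutation that moves \<open>k\<close>.  The surviving
  permutations are those of the range of \<open>f\<close>.  With \<open>f\<close> a constructor of a sum type this expands
  a block triangular determinant; with \<open>f\<close> bijective it reindexes a determinant.
\<close>

lemma det_unit_rows_outside:
  fixes B :: "real ^ 'k ^ 'k" and f :: "'a::finite \<Rightarrow> 'k"
  assumes f: "inj f"
    and unit: "\<And>k. k \<notin> range f \<Longrightarrow> B $ k = axis k 1"
  shows "det B = det (\<chi> i j. B $ f i $ f j)"
proof -
  let ?term = "\<lambda>p. of_int (sign p) * (\<Prod>k\<in>UNIV. B $ k $ p k)"
  have bij: "bij_betw f UNIV (range f)"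
    using f by (simp add: bij_betw_def)
  have vanish: "?term p = 0" if "p permutes UNIV" "\<not> p permutes range f" for p
  proof -
    have "\<exists>k. k \<notin> range f \<and> p k \<noteq> k"
      using permutes_superset[OF that(1), of "range f"] that(2) by blast
    then obtain k where k: "k \<notin> range f" "p k \<noteq> k"
      by blast
    then have "B $ k $ p k = 0"
      by (simp add: unit axis_def)
    then have "(\<Prod>k\<in>UNIV. B $ k $ p k) = 0"
      by (intro prod_zero) auto
    then show ?thesis
      by simp
  qed
  have "det B = (\<Sum>p | p permutes range f. ?term p)"
    unfolding det_def
    by (rule sum.mono_neutral_right)
      (auto simp: finite_permutations vanish intro: permutes_subset)
  also have "\<dots> = (\<Sum>p | p permutes UNIV. ?term (map_permutation UNIV f p))"
    using bij_betw_permutations[OF bij]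
    by (intro sum.reindex_bij_betw[symmetric])
      (simp add: map_permutation_def[abs_def] restrict_id_def o_def)
  also have "\<dots> = det (\<chi> i j. B $ f i $ f j)"
    unfolding det_def
  proof (rule sum.cong)
    fix p :: "'a \<Rightarrow> 'a"
    assume "p \<in> {p. p permutes UNIV}"
    then have p: "p permutes UNIV" by simp
    let ?q = "map_permutation UNIV f p"
    have q: "?q permutes range f"
      by (rule map_permutation_permutes[OF bij p])
    have "(\<Prod>k\<in>UNIV. B $ k $ ?q k) = (\<Prod>k\<in>range f. B $ k $ ?q k)"
      by (rule prod.mono_neutral_right) (auto simp: unit axis_def permutes_not_in[OF q])
    also have "\<dots> = (\<Prod>i\<in>UNIV. B $ f i $ f (p i))"
      using f by (simp add: prod.reindex map_permutation_apply)
    finally show "?term ?q = of_int (sign p) * (\<Prod>i\<in>UNIV. (\<chi> i j. B $ f i $ f j) $ i $ p i)"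
      using f p by (simp add: sign_map_permutation)
  qed simp
  finally show ?thesis .
qed

definition block_matrix ::
  "real ^ 'a ^ 'a \<Rightarrow> real ^ 'b ^ 'a \<Rightarrow> real ^ 'a ^ 'b \<Rightarrow> real ^ 'b ^ 'b
    \<Rightarrow> real ^ ('a::finite + 'b::finite) ^ ('a + 'b)" where
  "block_matrix A B C D = (\<chi> p q.
     case p of
       Inl i \<Rightarrow> (case q of Inl j \<Rightarrow> A $ i $ j | Inr j \<Rightarrow> B $ i $ j)
     | Inr i \<Rightarrow> (case q of Inl j \<Rightarrow> C $ i $ j | Inr j \<Rightarrow> D $ i $ j))"

lemma sum_over_sum_type:
  fixes f :: "'a::finite + 'b::finite \<Rightarrow> real"
  shows "(\<Sum>p\<in>UNIV. f p) = (\<Sum>i\<in>UNIV. f (Inl i)) + (\<Sum>j\<in>UNIV. f (Inr j))"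
  by (simp add: UNIV_Plus_UNIV[symmetric] sum.Plus del: UNIV_Plus_UNIV)

lemma sum_over_prod_type:
  fixes f :: "'a::finite \<times> 'b::finite \<Rightarrow> real"
  shows "(\<Sum>p\<in>UNIV. f p) = (\<Sum>i\<in>UNIV. \<Sum>j\<in>UNIV. f (i, j))"
  by (simp add: UNIV_Times_UNIV[symmetric] sum.cartesian_product del: UNIV_Times_UNIV)

lemma sum_if_const: "(\<Sum>i\<in>S. if P then f i else 0) = (if P then sum f S else 0)"
  by simp

lemma block_matrix_mult:
  "block_matrix A B C D ** block_matrix A' B' C' D' =
     block_matrix (A ** A' + B ** C') (A ** B' + B ** D') (C ** A' + D ** C') (C ** B' + D ** D')"
  by (auto simp: vec_eq_iff matrix_matrix_mult_def block_matrix_def sum_over_sum_type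
      split: sum.split)

lemma det_block_matrix_unit_lower_row:
  fixes B :: "real ^ 'b::finite ^ 'a::finite"
  shows "det (block_matrix A B 0 (mat 1)) = det A"
proof -
  have "det (block_matrix A B 0 (mat 1)) =
      det (\<chi> i j. block_matrix A B 0 (mat 1) $ Inl i $ Inl j)"
  proof (rule det_unit_rows_outside)
    fix k :: "'a + 'b"
    assume "k \<notin> range Inl"
    then obtain i where "k = Inr i"
      by (cases k) auto
    then show "block_matrix A B 0 (mat 1) $ k = axis k 1"
      by (auto simp: vec_eq_iff block_matrix_def axis_def mat_def split: sum.split)
  qed simp
  then show ?thesis
    by (simp add: block_matrix_def vec_lambda_eta)
qed

lemma det_block_matrix_unit_upper_row:
  fixes C :: "real ^ 'a::finite ^ 'b::finite"
  shows "det (block_matrix (mat 1) 0 C D) = det D"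
proof -
  have "det (block_matrix (mat 1) 0 C D) =
      det (\<chi> i j. block_matrix (mat 1) 0 C D $ Inr i $ Inr j)"
  proof (rule det_unit_rows_outside)
    fix k :: "'a + 'b"
    assume "k \<notin> range Inr"
    then obtain i where "k = Inl i"
      by (cases k) auto
    then show "block_matrix (mat 1) 0 C D $ k = axis k 1"
      by (auto simp: vec_eq_iff block_matrix_def axis_def mat_def split: sum.split)
  qed simp
  then show ?thesis
    by (simp add: block_matrix_def vec_lambda_eta)
qed

text \<open>Factoring out a unit lower triangular matrix leaves the Schur complement.\<close>

lemma det_block_matrix_unit_diagonal:
  fixes X :: "real ^ 'b::finite ^ 'a::finite"
  shows "det (block_matrix (mat 1) X Y (mat 1)) = det (mat 1 - X ** Y)"
proof -
  have "block_matrix (mat 1) X Y (mat 1) =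
      block_matrix (mat 1 - X ** Y) X 0 (mat 1) ** block_matrix (mat 1) 0 Y (mat 1)"
    by (simp add: block_matrix_mult)
  then show ?thesis
    by (simp add: det_mul det_block_matrix_unit_lower_row det_block_matrix_unit_upper_row)
qed

lemma matrix_minus_mult: "(- A) ** B = - (A ** B :: real ^ 'c ^ 'a)"
  by (simp add: vec_eq_iff matrix_matrix_mult_def sum_negf)

lemma matrix_mult_minus: "A ** (- B) = - (A ** B :: real ^ 'c ^ 'a)"
  by (simp add: vec_eq_iff matrix_matrix_mult_def sum_negf)

lemma matrix_add_rdistrib: "(A + B) ** C = A ** C + (B ** C :: real ^ 'c ^ 'a)"
  by (simp add: vec_eq_iff matrix_matrix_mult_def distrib_right sum.distrib)

lemma matrix_diff_rdistrib: "(A - B) ** C = A ** C - (B ** C :: real ^ 'c ^ 'a)"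
  by (simp add: vec_eq_iff matrix_matrix_mult_def left_diff_distrib sum_subtractf)

text \<open>
  Both sides are the determinant of one block matrix with unit diagonal blocks: eliminating the
  second block leaves the left-hand side, eliminating the first one leaves the right-hand side.
\<close>

lemma sylvester_determinant_identity:
  fixes X :: "real ^ 'b::finite ^ 'a::finite" and Y :: "real ^ 'a ^ 'b"
  shows "det (mat 1 + X ** Y) = det (mat 1 + Y ** X)"
proof -
  have "block_matrix (mat 1) (- X) Y (mat 1) =
      block_matrix (mat 1) 0 Y (mat 1) ** (block_matrix (mat 1) 0 0 (mat 1 + Y ** X) **
        block_matrix (mat 1) (- X) 0 (mat 1))"
    by (simp add: block_matrix_mult matrix_mult_minus)
  then have "det (block_matrix (mat 1) (- X) Y (mat 1)) = det (mat 1 + Y ** X)"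
    by (simp only: det_mul det_block_matrix_unit_upper_row det_block_matrix_unit_lower_row
        det_I mult_1_left mult_1_right)
  moreover have "det (block_matrix (mat 1) (- X) Y (mat 1)) = det (mat 1 + X ** Y)"
    by (simp add: det_block_matrix_unit_diagonal matrix_minus_mult)
  ultimately show ?thesis
    by simp
qed

text \<open>
  Linear algebra of an implicit step: an input \<open>v\<close> determines internal variables \<open>P v\<close> by the
  implicit equation with input matrix \<open>W\<close> and internal coupling \<open>L\<close>, and these feed back into the
  output through \<open>V\<close>.  Eliminating \<open>P\<close> gives \<open>J = U (I + U' V (I - L)\<^sup>-\<^sup>1 W)\<close>, and Sylvester's
  identity turns the determinant of the second factor into one on the space of internal variables.
\<close>

lemma det_implicit_step:
  fixes U U' :: "real ^ 'm ^ 'm" and W P :: "real ^ 'm ^ 'k" and V :: "real ^ 'k ^ 'm"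
    and L :: "real ^ 'k ^ 'k"
  assumes P: "P = W + L ** P"
    and J: "J = U + V ** P"
    and inv: "invertible (mat 1 - L)"
    and U: "U ** U' = mat 1"
  shows "det J * det (mat 1 - L) = det U * det (mat 1 - L + W ** U' ** V)"
proof -
  obtain T where T: "T ** (mat 1 - L) = mat 1"
    using inv by (auto simp: invertible_def)
  have "(mat 1 - L) ** P = W"
    by (simp add: matrix_diff_rdistrib diff_eq_eq P[symmetric])
  then have "P = T ** W"
    using T by (metis matrix_mul_assoc matrix_mul_lid)
  then have "J = U ** (mat 1 + (U' ** V ** T) ** W)"
    by (simp add: J matrix_add_ldistrib matrix_mul_assoc U)
  then have "det J = det U * det (mat 1 + W ** (U' ** V ** T))"
    using sylvester_determinant_identity[of "U' ** V ** T" W] by (simp only: det_mul)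
  moreover have "W ** (U' ** V ** T) ** (mat 1 - L) = W ** U' ** V"
    using T by (metis matrix_mul_assoc matrix_mul_rid)
  then have "(mat 1 + W ** (U' ** V ** T)) ** (mat 1 - L) = mat 1 - L + W ** U' ** V"
    by (simp add: matrix_add_rdistrib)
  then have "det (mat 1 + W ** (U' ** V ** T)) * det (mat 1 - L) = det (mat 1 - L + W ** U' ** V)"
    by (metis det_mul)
  ultimately show ?thesis
    by simp
qed

section \<open>Linearization of the stage equations\<close>

text \<open>The Kronecker product of \<open>M\<close> with the identity matrix of size \<open>d\<close>.\<close>

definition stage_coupling :: "real ^ 's ^ 's \<Rightarrow> real ^ ('s \<times> 'n) ^ ('s::finite \<times> 'n::finite)" where
  "stage_coupling M = (\<chi> p q. if snd p = snd q then M $ fst p $ fst q else 0)"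

definition stage_blocks :: "('s \<Rightarrow> real ^ 'n ^ 'n) \<Rightarrow> real ^ ('s \<times> 'n) ^ ('s::finite \<times> 'n::finite)" where
  "stage_blocks G = (\<chi> p q. if fst p = fst q then G (fst q) $ snd p $ snd q else 0)"

definition stage_field ::
  "(real ^ 'n \<Rightarrow> real ^ 'n) \<Rightarrow> real ^ ('s \<times> 'n) \<Rightarrow> real ^ ('s::finite \<times> 'n::finite)" where
  "stage_field g Z = (\<chi> p. g (stage Z (fst p)) $ snd p)"

definition free_flow :: "real \<Rightarrow> real ^ ('n + 'n) ^ ('n::finite + 'n)" where
  "free_flow h = block_matrix (mat 1) (mat h) 0 (mat 1)"

text \<open>
  The explicit dependence of the stages on \<open>(q\<^sub>n, q\<^sub>n')\<close>, and the dependence of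
  \<open>(q\<^sub>n\<^sub>+\<^sub>1, q\<^sub>n\<^sub>+\<^sub>1')\<close> on the stage values of \<open>g\<close>.  With these the method is linear in its arguments
  and the values of \<open>g\<close>, and differentiation only has to treat \<open>stage_field\<close>.
\<close>

definition stage_input :: "real ^ 's \<Rightarrow> real \<Rightarrow> real ^ ('n + 'n) ^ ('s::finite \<times> 'n::finite)" where
  "stage_input c h = (\<chi> p r. case r of
     Inl k \<Rightarrow> if snd p = k then 1 else 0
   | Inr k \<Rightarrow> if snd p = k then h * c $ fst p else 0)"

definition stage_output ::
  "real ^ 's \<Rightarrow> real ^ 's \<Rightarrow> real \<Rightarrow> real ^ ('s \<times> 'n) ^ ('n::finite + 'n)" where
  "stage_output b c h = (\<chi> r q. case r of
     Inl k \<Rightarrow> if k = snd q then h\<^sup>2 * (b $ fst q * (1 - c $ fst q)) else 0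
   | Inr k \<Rightarrow> if k = snd q then h * b $ fst q else 0)"

lemma stage_coupling_blocks_nth:
  "(stage_coupling M ** stage_blocks G) $ p $ q =
     M $ fst p $ fst q * G (fst q) $ snd p $ snd q"
  by (simp add: matrix_matrix_mult_def stage_coupling_def stage_blocks_def sum_over_prod_type
      sum_if_const
      if_distrib[of "\<lambda>x. x * y" for y] if_distrib[of "\<lambda>x. y * x" for y] cong: if_cong)

lemma det_free_flow: "det (free_flow h) = 1"
  by (simp add: free_flow_def det_block_matrix_unit_lower_row)

lemma free_flow_inverse:
  "free_flow h ** free_flow (- h) = (mat 1 :: real ^ ('n + 'n) ^ ('n::finite + 'n))"
proof -
  have "mat (- h) + mat h = (0 :: real ^ 'n ^ 'n)"
    by (simp add: vec_eq_iff mat_def)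
  then have "free_flow h ** free_flow (- h) =
      (block_matrix (mat 1) 0 0 (mat 1) :: real ^ ('n + 'n) ^ ('n + 'n))"
    by (simp add: free_flow_def block_matrix_mult)
  also have "\<dots> = mat 1"
    by (auto simp: block_matrix_def vec_eq_iff mat_def split: sum.split)
  finally show ?thesis .
qed

text \<open>
  Undoing the free flow replaces the weight \<open>h\<^sup>2 b\<^sub>j (1 - c\<^sub>j)\<close> in the position by
  \<open>- h\<^sup>2 b\<^sub>j c\<^sub>j\<close>; reading this off at time \<open>c\<^sub>i\<close> adds \<open>h c\<^sub>i\<close> times the velocity weight
  \<open>h b\<^sub>j\<close>.  The result again has the form of a coupling of the stages, with the same factor
  \<open>c\<^sub>i - c\<^sub>j\<close> as in the stage equations.
\<close>

lemma stage_input_free_flow_output: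
  "stage_input c h ** free_flow (- h) ** stage_output b c h =
     (stage_coupling (\<chi> i j. h\<^sup>2 * (b $ j * (c $ i - c $ j)))
       :: real ^ ('s \<times> 'n) ^ ('s::finite \<times> 'n::finite))"
proof -
  have "free_flow (- h) ** stage_output b c h = ((\<chi> r q. case r of
      Inl k \<Rightarrow> if k = snd q then - (h\<^sup>2 * (b $ fst q * c $ fst q)) else 0
    | Inr k \<Rightarrow> if k = snd q then h * b $ fst q else 0) :: real ^ ('s \<times> 'n) ^ ('n + 'n))"
    by (simp add: vec_eq_iff matrix_matrix_mult_def free_flow_def stage_output_def
        block_matrix_def mat_def sum_over_sum_type split_sum_all
        if_distrib[of "\<lambda>x. x * y" for y] if_distrib[of "\<lambda>x. y * x" for y] cong: if_cong)
      (simp add: right_diff_distrib power2_eq_square)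
  then show ?thesis
    unfolding matrix_mul_assoc[symmetric]
    by (simp only:)
      (simp add: vec_eq_iff matrix_matrix_mult_def stage_input_def stage_coupling_def
        sum_over_sum_type if_distrib[of "\<lambda>x. x * y" for y] if_distrib[of "\<lambda>x. y * x" for y]
        right_diff_distrib power2_eq_square mult.left_commute cong: if_cong)
qed

lemma stage_nth: "stage Z i $ k = Z $ (i, k)"
  by (simp add: stage_def)

lemma stage_field_has_derivative:
  fixes Z :: "real ^ ('s::finite \<times> 'n::finite)"
  assumes "\<And>q. g differentiable (at q)"
  shows "(stage_field g has_derivative
      (*v) (stage_blocks (\<lambda>i. jacobian g (at (stage Z i))))) (at Z)"
proof -
  have "((\<lambda>Z. stage_field g Z $ p) has_derivative
      (\<lambda>H. (stage_blocks (\<lambda>i. jacobian g (at (stage Z i))) *v H) $ p)) (at Z)" for p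
  proof -
    obtain i k where p: "p = (i, k)" by (cases p)
    have "linear (\<lambda>Z :: real ^ ('s \<times> 'n). stage Z i)"
      by (rule linearI) (simp_all add: stage_def vec_eq_iff)
    then have "((\<lambda>Z. stage Z i) has_derivative (\<lambda>H. stage H i)) (at Z)"
      by (simp add: linear_conv_bounded_linear bounded_linear_imp_has_derivative)
    moreover have "(g has_derivative (*v) (jacobian g (at (stage Z i)))) (at (stage Z i))"
      using assms jacobian_works by blast
    ultimately have "((\<lambda>Z. g (stage Z i)) has_derivative
        (\<lambda>H. jacobian g (at (stage Z i)) *v stage H i)) (at Z)"
      by (rule has_derivative_compose)
    then have "((\<lambda>Z. g (stage Z i) $ k) has_derivative
        (\<lambda>H. (jacobian g (at (stage Z i)) *v stage H i) $ k)) (at Z)"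
      by (rule bounded_linear.has_derivative[OF bounded_linear_vec_nth])
    moreover have "(jacobian g (at (stage Z i)) *v stage H i) $ k =
        (stage_blocks (\<lambda>i. jacobian g (at (stage Z i))) *v H) $ p" for H
      by (simp add: p matrix_vector_mult_def stage_blocks_def stage_nth sum_over_prod_type
          if_distrib[of "\<lambda>x. x * y" for y] sum_if_const cong: if_cong)
    ultimately show ?thesis
      by (simp add: p stage_field_def)
  qed
  then show ?thesis
    unfolding has_derivative_componentwise_within[of "stage_field g"]
    by (auto simp: Basis_vec_def inner_axis)
qed

lemma stage_rhs_linear_form:
  "(\<chi> p. stage_rhs A c h g x Z (fst p) $ snd p) =
     stage_input c h *v x +
     stage_coupling (\<chi> i j. h\<^sup>2 * (A $ i $ j * (c $ i - c $ j))) *v stage_field g Z"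
  by (auto simp: vec_eq_iff stage_rhs_def position_def velocity_def stage_input_def
      stage_coupling_def stage_field_def matrix_vector_mult_def sum_over_sum_type sum_over_prod_type
      if_distrib[of "\<lambda>x. x * y" for y] sum_distrib_left mult.assoc cong: if_cong)

lemma rkn_step_linear_form:
  "rkn_step b c h g Q x = free_flow h *v x + stage_output b c h *v stage_field g (Q x)"
  by (auto simp: vec_eq_iff rkn_step_def phase_point_def position_def velocity_def free_flow_def
      block_matrix_def mat_def stage_output_def stage_field_def matrix_vector_mult_def
      sum_over_sum_type sum_over_prod_type if_distrib[of "\<lambda>x. x * y" for y]
      sum_distrib_left mult.assoc cong: if_cong split: sum.split)

lemma jacobian_eqI:
  fixes f :: "real ^ 'a \<Rightarrow> real ^ 'b"
  assumes "(f has_derivative (*v) M) (at x)"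
  shows "jacobian f (at x) = M"
  using assms by (metis frechet_derivative_at jacobian_def matrix_of_matrix_vector_mul)

definition stage_determinant :: "real ^ 's ^ 's \<Rightarrow> ('s::finite \<Rightarrow> real ^ 'n::finite ^ 'n) \<Rightarrow> real" where
  "stage_determinant M G = det (mat 1 - stage_coupling M ** stage_blocks G)"

text \<open>
  Differentiating the identity satisfied by the stages gives an implicit equation for the
  derivative \<open>P\<close> of \<open>Q\<close>, whose matrix is the Jacobian matrix of the stage system.
  The numerator arises because the feedback coupling, of coefficients
  \<open>h\<^sup>2 b\<^sub>j (c\<^sub>i - c\<^sub>j)\<close>, is subtracted from the coupling in the stage equations.
\<close>

lemma rkn_step_jacobian:
  fixes A :: "real ^ 's::finite ^ 's" and g :: "real ^ 'n::finite \<Rightarrow> real ^ 'n" and x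
  assumes g: "\<And>q. g differentiable (at q)"
    and sol: "stage_solution A c h g Q"
  defines "G \<equiv> \<lambda>i. jacobian g (at (stage (Q x) i))"
  shows rkn_step_differentiable: "rkn_step b c h g Q differentiable (at x)"
    and stage_det_nonzero:
      "stage_determinant (\<chi> i j. h\<^sup>2 * (A $ i $ j * (c $ i - c $ j))) G \<noteq> 0"
    and det_rkn_step_jacobian:
      "det (jacobian (rkn_step b c h g Q) (at x)) *
         stage_determinant (\<chi> i j. h\<^sup>2 * (A $ i $ j * (c $ i - c $ j))) G =
       stage_determinant (\<chi> i j. h\<^sup>2 * ((A $ i $ j - b $ j) * (c $ i - c $ j))) G"
proof -
  let ?F = "stage_field g :: real ^ ('s \<times> 'n) \<Rightarrow> _"
  let ?B = "stage_blocks G :: real ^ ('s \<times> 'n) ^ ('s \<times> 'n)"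
  define K where "K = (stage_coupling (\<chi> i j. h\<^sup>2 * (A $ i $ j * (c $ i - c $ j)))
      :: real ^ ('s \<times> 'n) ^ ('s \<times> 'n))"
  define P where "P = jacobian Q (at x)"
  have F: "(?F has_derivative (*v) ?B) (at (Q x))"
    unfolding G_def by (rule stage_field_has_derivative[OF g])
  have Q: "(Q has_derivative (*v) P) (at x)"
    using sol unfolding P_def stage_solution_def by (metis jacobian_works)
  have FQ: "((\<lambda>x. ?F (Q x)) has_derivative (\<lambda>v. ?B *v (P *v v))) (at x)"
    by (rule has_derivative_compose[OF Q F])
  have lin: "((*v) M has_derivative (*v) M) F" for M :: "real ^ 'a ^ 'b" and F
    by (simp add: bounded_linear_imp_has_derivative)
  have mv: "((\<lambda>x. M *v f x) has_derivative (\<lambda>v. M *v f' v)) F"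
    if "(f has_derivative f') F" for M :: "real ^ 'a ^ 'b" and f f' F
    using that by (rule bounded_linear.has_derivative[OF matrix_vector_mul_bounded_linear])
  have mv_add: "(*v) (M + N) = (\<lambda>v. M *v v + N *v v)" for M N :: "real ^ 'a ^ 'b"
    by (simp add: fun_eq_iff matrix_vector_mult_add_rdistrib)
  have mv_diff: "(*v) (mat 1 - M) = (\<lambda>v. v - M *v v)" for M :: "real ^ 'a ^ 'a"
    by (simp add: fun_eq_iff matrix_vector_mult_diff_rdistrib)

  have stages: "Q x = stage_input c h *v x + K *v ?F (Q x)" for x
  proof -
    have "Q x = (\<chi> p. stage (Q x) (fst p) $ snd p)"
      by (simp add: vec_eq_iff stage_nth)
    also have "\<dots> = (\<chi> p. stage_rhs A c h g x (Q x) (fst p) $ snd p)"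
      using sol by (simp add: stage_solution_def)
    finally show ?thesis
      by (simp only: stage_rhs_linear_form K_def)
  qed
  have "((\<lambda>x. stage_input c h *v x + K *v ?F (Q x)) has_derivative
      (\<lambda>v. stage_input c h *v v + K *v (?B *v (P *v v)))) (at x)"
    by (intro has_derivative_add lin mv FQ)
  then have "(Q has_derivative (*v) (stage_input c h + K ** ?B ** P)) (at x)"
    by (simp add: stages[symmetric] mv_add matrix_vector_mul_assoc matrix_mul_assoc)
  then have P: "P = stage_input c h + K ** ?B ** P"
    unfolding P_def by (rule jacobian_eqI)

  have residual: "stage_residual A c h g x Z = Z - (stage_input c h *v x + K *v ?F Z)" for Z
  proof -
    have "stage_residual A c h g x Z = Z - (\<chi> p. stage_rhs A c h g x Z (fst p) $ snd p)"
      by (simp add: vec_eq_iff stage_residual_def stage_nth)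
    then show ?thesis
      by (simp only: stage_rhs_linear_form K_def)
  qed
  have "((\<lambda>Z. Z - (stage_input c h *v x + K *v ?F Z)) has_derivative
      (\<lambda>H. H - (0 + K *v (?B *v H)))) (at (Q x))"
    by (intro has_derivative_diff has_derivative_add has_derivative_const has_derivative_ident mv F)
  then have "(stage_residual A c h g x has_derivative (*v) (mat 1 - K ** ?B)) (at (Q x))"
    by (simp add: residual[abs_def] mv_diff matrix_vector_mul_assoc)
  then have "jacobian (stage_residual A c h g x) (at (Q x)) = mat 1 - K ** ?B"
    by (rule jacobian_eqI)
  then have inv: "invertible (mat 1 - K ** ?B)"
    using sol unfolding stage_solution_def by metis
  then show "stage_determinant (\<chi> i j. h\<^sup>2 * (A $ i $ j * (c $ i - c $ j))) G \<noteq> 0"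
    by (simp add: stage_determinant_def K_def invertible_det_nz)

  have "((\<lambda>x. free_flow h *v x + stage_output b c h *v ?F (Q x)) has_derivative
      (\<lambda>v. free_flow h *v v + stage_output b c h *v (?B *v (P *v v)))) (at x)"
    by (intro has_derivative_add lin mv FQ)
  then have step: "(rkn_step b c h g Q has_derivative
      (*v) (free_flow h + stage_output b c h ** ?B ** P)) (at x)"
    by (simp add: rkn_step_linear_form[abs_def] mv_add matrix_vector_mul_assoc matrix_mul_assoc)
  then show "rkn_step b c h g Q differentiable (at x)"
    by (rule differentiableI)
  have J: "jacobian (rkn_step b c h g Q) (at x) = free_flow h + stage_output b c h ** ?B ** P"
    using step by (rule jacobian_eqI)
  have coupling: "mat 1 - K ** ?B + stage_input c h ** free_flow (- h) ** (stage_output b c h ** ?B) =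
      mat 1 - stage_coupling (\<chi> i j. h\<^sup>2 * ((A $ i $ j - b $ j) * (c $ i - c $ j))) ** ?B"
    by (simp add: matrix_mul_assoc stage_input_free_flow_output)
       (simp add: K_def vec_eq_iff stage_coupling_blocks_nth algebra_simps)
  then show "det (jacobian (rkn_step b c h g Q) (at x)) *
         stage_determinant (\<chi> i j. h\<^sup>2 * (A $ i $ j * (c $ i - c $ j))) G =
       stage_determinant (\<chi> i j. h\<^sup>2 * ((A $ i $ j - b $ j) * (c $ i - c $ j))) G"
    using det_implicit_step[OF P J inv free_flow_inverse]
    by (simp only: coupling stage_determinant_def K_def[symmetric] det_free_flow mult_1_left)
qed

section \<open>Symmetries of the stage determinant\<close>

text \<open>
  Multiplying each stage by a nonzero scalar commutes with the block diagonal matrix of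
  the \<open>G\<^sub>i\<close>, so it conjugates the coefficients only.
\<close>

lemma stage_determinant_rescale:
  fixes M N :: "real ^ 's::finite ^ 's"
  assumes w: "\<And>i. w i \<noteq> 0"
    and MN: "\<And>i j. w i * N $ i $ j = M $ i $ j * w j"
  shows "stage_determinant M G = stage_determinant N (G :: 's \<Rightarrow> real ^ 'n::finite ^ 'n)"
proof -
  define D where "D = (\<chi> p q. if p = q then w (fst p) else 0 :: real ^ ('s \<times> 'n) ^ ('s \<times> 'n))"
  have "det D \<noteq> 0"
    using w by (simp add: D_def det_diagonal)
  moreover have "D ** (mat 1 - stage_coupling N ** stage_blocks G) =
      (mat 1 - stage_coupling M ** stage_blocks G) ** D"
  proof -
    have left: "(D ** X) $ p $ q = w (fst p) * X $ p $ q"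
      and right: "(X ** D) $ p $ q = X $ p $ q * w (fst q)" for X p q
      by (simp_all add: D_def matrix_matrix_mult_def if_distrib[of "\<lambda>x. x * y" for y]
          if_distrib[of "\<lambda>x. y * x" for y] cong: if_cong)
    have "N $ i $ j = M $ i $ j * w j / w i" for i j
      using MN[of i j] w[of i] by (simp add: field_simps)
    then show ?thesis
      using w by (auto simp: vec_eq_iff left right stage_coupling_blocks_nth mat_def algebra_simps)
  qed
  ultimately show ?thesis
    unfolding stage_determinant_def by (metis det_mul mult.commute mult_cancel_left)
qed

text \<open>
  Symplecticity in the form \<open>b\<^sub>i (a\<^sub>i\<^sub>j - b\<^sub>j) = - b\<^sub>j a\<^sub>j\<^sub>i\<close>; the sign is absorbed by
  \<open>c\<^sub>i - c\<^sub>j = - (c\<^sub>j - c\<^sub>i)\<close>.  The weights \<open>b\<close> themselves are the rescaling.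
\<close>

lemma symplectic_stage_determinant:
  assumes sym: "symplectic_rk A b" and b: "\<forall>j. b $ j \<noteq> 0"
  shows "stage_determinant (\<chi> i j. h\<^sup>2 * ((A $ i $ j - b $ j) * (c $ i - c $ j))) G =
    stage_determinant (\<chi> i j. h\<^sup>2 * (A $ j $ i * (c $ j - c $ i))) G"
proof (rule stage_determinant_rescale[symmetric])
  fix i j
  have "b $ i * (A $ i $ j - b $ j) = - (b $ j * A $ j $ i)"
    using sym unfolding symplectic_rk_def by (simp add: algebra_simps)
  then show "b $ i * (\<chi> i j. h\<^sup>2 * ((A $ i $ j - b $ j) * (c $ i - c $ j))) $ i $ j =
      (\<chi> i j. h\<^sup>2 * (A $ j $ i * (c $ j - c $ i))) $ i $ j * b $ j"
    by simp algebra
qed (use b in auto)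

text \<open>
  Ordering the coordinates by stages makes this a block determinant with unit diagonal blocks.
  The off-diagonal coefficients then enter only through their product.
\<close>

lemma stage_determinant_two_stages:
  fixes M :: "real ^ 2 ^ 2" and G :: "2 \<Rightarrow> real ^ 'n::finite ^ 'n"
  assumes diag: "\<And>i. M $ i $ i = 0"
  shows "stage_determinant M G = det (mat 1 - (M $ 1 $ 2 * M $ 2 $ 1) *\<^sub>R (G 2 ** G 1))"
proof -
  define f :: "'n + 'n \<Rightarrow> 2 \<times> 'n" where "f = case_sum (Pair 1) (Pair 2)"
  have "inj f"
    by (auto simp: inj_def f_def split: sum.splits)
  have "range f = UNIV"
  proof (intro set_eqI iffI UNIV_I)
    fix p :: "2 \<times> 'n"
    show "p \<in> range f"
      using exhaust_2[of "fst p"]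
      by (cases p) (auto simp: f_def image_iff split: sum.split intro: exI[of _ "Inl _"] exI[of _ "Inr _"])
  qed
  let ?S = "mat 1 - stage_coupling M ** stage_blocks G"
  have "stage_determinant M G = det (\<chi> i j. ?S $ f i $ f j)"
    unfolding stage_determinant_def
    by (rule det_unit_rows_outside) (use \<open>inj f\<close> \<open>range f = UNIV\<close> in auto)
  also have "(\<chi> i j. ?S $ f i $ f j) =
      block_matrix (mat 1) (- M $ 1 $ 2 *\<^sub>R G 2) (- M $ 2 $ 1 *\<^sub>R G 1) (mat 1)"
    by (auto simp: vec_eq_iff block_matrix_def f_def mat_def stage_coupling_blocks_nth diag
        split: sum.split)
  also have "det \<dots> = det (mat 1 - (M $ 1 $ 2 * M $ 2 $ 1) *\<^sub>R (G 2 ** G 1))"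
  proof -
    have "(- M $ 1 $ 2 *\<^sub>R G 2) ** (- M $ 2 $ 1 *\<^sub>R G 1) =
        (M $ 1 $ 2 * M $ 2 $ 1) *\<^sub>R (G 2 ** G 1)"
      by (simp add: matrix_matrix_mult_def vec_eq_iff sum_distrib_left mult_ac)
    then show ?thesis
      by (simp only: det_block_matrix_unit_diagonal)
  qed
  finally show ?thesis .
qed

lemma volume_preserving_if_transposition_invariant:
  fixes A :: "real ^ 's::finite ^ 's" and g :: "real ^ 'n::finite \<Rightarrow> real ^ 'n"
  assumes g: "\<And>q. g differentiable (at q)"
    and sym: "symplectic_rk A b" and b: "\<forall>j. b $ j \<noteq> 0" and sol: "stage_solution A c h g Q"
    and transposed: "\<And>G :: 's \<Rightarrow> real ^ 'n ^ 'n.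
      stage_determinant (\<chi> i j. h\<^sup>2 * (A $ j $ i * (c $ j - c $ i))) G =
      stage_determinant (\<chi> i j. h\<^sup>2 * (A $ i $ j * (c $ i - c $ j))) G"
  shows "volume_preserving (rkn_step b c h g Q)"
  unfolding volume_preserving_def
proof (intro allI conjI)
  fix x
  show "rkn_step b c h g Q differentiable (at x)"
    by (rule rkn_step_differentiable[OF g sol])
  show "det (jacobian (rkn_step b c h g Q) (at x)) = 1"
    using det_rkn_step_jacobian[OF g sol, of b x] stage_det_nonzero[OF g sol, of x]
    by (simp add: symplectic_stage_determinant[OF sym b] transposed)
qed

section \<open>Volume preservation\<close>

text \<open>A coefficient matrix with a single entry equals its transpose.\<close>

lemma one_stage_volume_preserving:
  fixes A :: "real ^ 1 ^ 1" and g :: "real ^ 'n::finite \<Rightarrow> real ^ 'n"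
  assumes "\<And>q. g differentiable (at q)"
    and "symplectic_rk A b" "\<forall>j. b $ j \<noteq> 0" "stage_solution A c h g Q"
  shows "volume_preserving (rkn_step b c h g Q)"
proof (rule volume_preserving_if_transposition_invariant[OF assms])
  have "(\<chi> i j. h\<^sup>2 * (A $ j $ i * (c $ j - c $ i))) = (\<chi> i j. h\<^sup>2 * (A $ i $ j * (c $ i - c $ j)))"
    by (simp add: vec_eq_iff)
  then show "stage_determinant (\<chi> i j. h\<^sup>2 * (A $ j $ i * (c $ j - c $ i))) G =
      stage_determinant (\<chi> i j. h\<^sup>2 * (A $ i $ j * (c $ i - c $ j))) G"
    for G :: "1 \<Rightarrow> real ^ 'n ^ 'n"
    by simp
qed

text \<open>
  The coefficients vanish on the diagonal because of the factor \<open>c\<^sub>i - c\<^sub>i\<close>, and transposition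
  only exchanges the two factors of the product \<open>m\<^sub>1\<^sub>2 m\<^sub>2\<^sub>1\<close>.
\<close>

lemma two_stage_volume_preserving:
  fixes A :: "real ^ 2 ^ 2" and g :: "real ^ 'n::finite \<Rightarrow> real ^ 'n"
  assumes "\<And>q. g differentiable (at q)"
    and "symplectic_rk A b" "\<forall>j. b $ j \<noteq> 0" "stage_solution A c h g Q"
  shows "volume_preserving (rkn_step b c h g Q)"
  by (rule volume_preserving_if_transposition_invariant[OF assms])
    (simp add: stage_determinant_two_stages mult.commute)

lemma volume_preserving_compose:
  assumes "volume_preserving \<Phi>" "volume_preserving \<Psi>"
  shows "volume_preserving (\<Psi> \<circ> \<Phi>)"
  unfolding volume_preserving_def
proof (intro allI conjI)
  fix x
  let ?J = "jacobian \<Phi> (at x)" and ?K = "jacobian \<Psi> (at (\<Phi> x))"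
  have "(\<Phi> has_derivative (*v) ?J) (at x)" "(\<Psi> has_derivative (*v) ?K) (at (\<Phi> x))"
    using assms unfolding volume_preserving_def by (metis jacobian_works)+
  then have "(\<Psi> \<circ> \<Phi> has_derivative (*v) ?K \<circ> (*v) ?J) (at x)"
    by (rule diff_chain_at)
  then have D: "(\<Psi> \<circ> \<Phi> has_derivative (*v) (?K ** ?J)) (at x)"
    by (simp add: o_def matrix_vector_mul_assoc)
  then show "(\<Psi> \<circ> \<Phi>) differentiable (at x)"
    by (rule differentiableI)
  have "jacobian (\<Psi> \<circ> \<Phi>) (at x) = ?K ** ?J"
    using D by (rule jacobian_eqI)
  then show "det (jacobian (\<Psi> \<circ> \<Phi>) (at x)) = 1"
    using assms by (simp add: det_mul volume_preserving_def)
qed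

theorem corollary5p6:
  fixes g :: "real ^ 'n \<Rightarrow> real ^ 'n"
  assumes "\<And>q. g differentiable (at q)"
  shows "(\<forall>(A :: real ^ 1 ^ 1) b c h Q.
            symplectic_rk A b \<and> (\<forall>j. b $ j \<noteq> 0) \<and> stage_solution A c h g Q
              \<longrightarrow> volume_preserving (rkn_step b c h g Q)) \<and>
         (\<forall>(A :: real ^ 2 ^ 2) b c h Q.
            symplectic_rk A b \<and> (\<forall>j. b $ j \<noteq> 0) \<and> stage_solution A c h g Q
              \<longrightarrow> volume_preserving (rkn_step b c h g Q)) \<and>
         (\<forall>\<Phi> \<in> rkn_compositions g. volume_preserving \<Phi>)"
proof (intro conjI ballI)
  show "\<forall>(A :: real ^ 1 ^ 1) b c h Q.
      symplectic_rk A b \<and> (\<forall>j. b $ j \<noteq> 0) \<and> stage_solution A c h g Q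
        \<longrightarrow> volume_preserving (rkn_step b c h g Q)"
    using one_stage_volume_preserving[OF assms] by blast
  show "\<forall>(A :: real ^ 2 ^ 2) b c h Q.
      symplectic_rk A b \<and> (\<forall>j. b $ j \<noteq> 0) \<and> stage_solution A c h g Q
        \<longrightarrow> volume_preserving (rkn_step b c h g Q)"
    using two_stage_volume_preserving[OF assms] by blast
  fix \<Phi>
  assume "\<Phi> \<in> rkn_compositions g"
  then show "volume_preserving \<Phi>"
  proof induction
    case one_stage
    then show ?case by (rule one_stage_volume_preserving[OF assms])
  next
    case two_stage
    then show ?case by (rule two_stage_volume_preserving[OF assms])
  next
    case compose
    then show ?case by (intro volume_preserving_compose)
  qed
qed

end
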